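(* Let $T$ be any rooted ordered tree with $n_T$ nodes labeled from an alphabet of size $\sigma$, and let $\mathcal{TD}$ be its top DAG (the minimal DAG representation of the top tree $\mathcal T$ of $T$ produced by the greedy construction described in the context). Then $n_{\mathcal{TD}} = O\big(n_T/(\log_\sigma n_T)^{0.19}\big)$.
   Context: A labeled tree $T$ is a rooted, ordered tree each of whose nodes carries a label from an alphabet of size $\sigma$; $n_T$ is its number of nodes and $p(v)$ denotes the parent of $v$. For a graph $G$, $n_G$ is its total size (number of vertices plus number of edges). Clusters. For a node $v$ with children $v_1,\dots,v_k$ (left to right), $T(v)$ is the subtree consisting of $v$ and its descendants, $F(v)$ the forest of proper descendants of $v$, and for $1\le s\le r\le k$, $T(v,v_s,v_r)$ is the tree pattern induced by $\{v\}\cup T(v_s)\cup\dots\cup T(v_r)$. A cluster with top boundary node $v$ is either a pattern $T(v,v_s,v_r)$ (no bottom boundary node) or a pattern $T(v,v_s,v_r)\setminus F(u)$ for a node $u$ of $T(v_s)\cup\dots\cup T(v_r)$ ($u$ is its bottom boundary node). A single edge $(v,p(v))$ is a cluster with top boundary $p(v)$, and with bottom boundary $v$ unless $v$ is a leaf of $T$. Two edge-disjoint clusters $A,B$ sharing one boundary node can be merged into $C=A\cup B$ (when $C$ is a cluster) in five ways: vertical merges, where the bottom boundary node of $A$ is the top boundary node of $B$ and $B$ contains all children of this node (allowed only if this node is a boundary node of no cluster other than $A,B$): type (a) if $B$ has a bottom boundary node, type (b) if not; horizontal merges, where $A,B$ have the same top boundary node, $A$ left of $B$, and at least one of them has no bottom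 boundary node: type (c) if only $A$ has a bottom boundary node, (d) if only $B$ has one, (e) if neither has one. $A$ is always the cluster first visited in a preorder traversal of $T$. Top tree. A top tree of $T$ is an ordered rooted binary labeled tree whose nodes correspond to clusters: the root to $T$, the leaves to the edges of $T$ (labeled by the pair (label of parent endpoint, label of child endpoint)), and each internal node to the merge of its left child's cluster $A$ and right child's cluster $B$, labeled by the merge type (a)–(e). Greedy construction. Maintain an auxiliary rooted ordered tree $\tilde T$, initially $T$, whose edges correspond to the current roots of the partial top tree (initially the edges of $T$). Merging edges $(u,v),(v,w)$ of $\tilde T$ creates a new top tree node whose children are the two corresponding clusters; if $v$ is the parent of $u$ and the only child of $w$ (vertical merge) the two edges are replaced by $(u,w)$; if $v$ is the parent of both $u,w$ and one of $u,w$ is a leaf (horizontal merge) they are replaced by a single edge from $v$ to one of $u,w$ (the non-leaf one, if any). While $\tilde T$ has more than one edge, do an iteration: Step 1 (horizontal): for each node $v$ of $\tilde T$ with children $v_1,\dots,v_k$, $k\ge 2$, for $i=1,\dots,\lfloor k/2\rfloor$ merge $(v,v_{2i-1}),(v,v_{2i})$ if $v_{2i-1}$ or $v_{2i}$ is a leaf; if $k$ is odd, $v_k$ is a leaf and $v_{k-2},v_{k-1}$ are non-leaves, also merge $(v,v_{k-1}),(v,v_k)$. Step 2 (vertical): for each maximal path $v_1,\dots,v_p$ with $v_{i+1}$ the parent of $v_i$ and $v_2,\dots,v_{p-1}$ each having exactly one child, with $e_i=(v_i,v_{i+1})$: if $p$ is even merge $\{e_1,e_2\},\{e_3,e_4\},\dots,\{e_{p-3},e_{p-2}\}$;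 if $p$ is odd merge $\{e_1,e_2\},\dots,\{e_{p-4},e_{p-3}\}$ and also $\{e_{p-2},e_{p-1}\}$ if $e_{p-1}$ was not merged in Step 1. Top DAG. The top DAG $\mathcal{TD}$ of $T$ is the minimal DAG representation of this top tree $\mathcal T$, in which identical rooted subtrees of $\mathcal T$ (same structure and labels) are represented once. *)

theory Defs
  imports Complex_Main
begin

section \<open>Labeled rooted ordered trees\<close>

datatype 'a tree = Node (root_label: 'a) (children: "'a tree list")

fun n_nodes :: "'a tree \<Rightarrow> nat" where
  "n_nodes (Node a ts) = 1 + sum_list (map n_nodes ts)"

text \<open>A node of a tree is addressed by the list of child indices on the path from the root to it.\<close>

type_synonym node = "nat list"

section \<open>Clusters and their merges\<close>

text \<open>A cluster is given by its nodes, its top boundary node, and its bottom boundary node, if any.\<close>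

datatype cluster =
  Cluster (cl_nodes: "node set") (cl_top: node) (cl_bottom: "node option")

text \<open>The cluster of the edge between the node \<open>v\<close> and its \<open>i\<close>-th child,
  where \<open>s\<close> is the subtree rooted at that child.\<close>

definition edge_cluster :: "node \<Rightarrow> nat \<Rightarrow> 'a tree \<Rightarrow> cluster" where
  "edge_cluster v i s =
     Cluster {v, v @ [i]} v (if children s = [] then None else Some (v @ [i]))"

datatype merge_type = Type_a | Type_b | Type_c | Type_d | Type_e

definition is_vertical :: "cluster \<Rightarrow> cluster \<Rightarrow> bool" where
  "is_vertical A B \<longleftrightarrow> cl_bottom A = Some (cl_top B)"

text \<open>In a merge of \<open>A\<close> and \<open>B\<close> that is not vertical, \<open>A\<close> and \<open>B\<close> share the top boundary
  node, \<open>A\<close> is left of \<open>B\<close>, and at most one of them has a bottom boundary node.\<close>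

definition type_of_merge :: "cluster \<Rightarrow> cluster \<Rightarrow> merge_type" where
  "type_of_merge A B =
     (if is_vertical A B then (if cl_bottom B \<noteq> None then Type_a else Type_b)
      else if cl_bottom A \<noteq> None then Type_c
      else if cl_bottom B \<noteq> None then Type_d
      else Type_e)"

definition merge_cluster :: "cluster \<Rightarrow> cluster \<Rightarrow> cluster" where
  "merge_cluster A B =
     Cluster (cl_nodes A \<union> cl_nodes B) (cl_top A)
       (if is_vertical A B \<or> cl_bottom A = None then cl_bottom B else cl_bottom A)"

section \<open>Top trees\<close>

datatype 'a top_tree =
    Edge 'a 'a
  | Merge merge_type "'a top_tree" "'a top_tree"

text \<open>A root of the partial top tree, together with the cluster it corresponds to.\<close>

type_synonym 'a part = "'a top_tree \<times> cluster"

fun merge_part :: "'a part \<Rightarrow> 'a part \<Rightarrow> 'a part" where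
  "merge_part (s, A) (t, B) = (Merge (type_of_merge A B) s t, merge_cluster A B)"

section \<open>The auxiliary tree\<close>

text \<open>A rooted ordered tree whose edges carry data: a node is the list of its outgoing edges
  from left to right, each with its data and the subtree below it.\<close>

datatype 'e aux_tree = Aux (edges: "('e \<times> 'e aux_tree) list")

fun n_edges :: "'e aux_tree \<Rightarrow> nat" where
  "n_edges (Aux es) = sum_list (map (\<lambda>(e, t). 1 + n_edges t) es)"

definition is_leaf :: "'e aux_tree \<Rightarrow> bool" where
  "is_leaf t \<longleftrightarrow> edges t = []"

function initial_aux :: "node \<Rightarrow> 'a tree \<Rightarrow> 'a part aux_tree" where
  "initial_aux v (Node a ts) =
     Aux (map (\<lambda>i. ((Edge a (root_label (ts ! i)), edge_cluster v i (ts ! i)),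
                    initial_aux (v @ [i]) (ts ! i)))
              [0..<length ts])"
  by pat_completeness auto
termination
  by (relation "measure (size \<circ> snd)")
     (auto simp: less_Suc_eq_le intro: size_list_estimation'[OF nth_mem])

section \<open>Step 1: horizontal merges\<close>

text \<open>The Boolean paired with an edge after this step tells whether the edge
  was created by a horizontal merge of the current iteration.\<close>

fun keep :: "'a part \<times> 'f aux_tree \<Rightarrow> ('a part \<times> bool) \<times> 'f aux_tree" where
  "keep (e, t) = ((e, False), t)"

fun hmerge :: "'a part \<times> 'f aux_tree \<Rightarrow> 'a part \<times> 'f aux_tree \<Rightarrow>
    ('a part \<times> bool) \<times> 'f aux_tree" where
  "hmerge (e, t) (e', t') = ((merge_part e e', True), if is_leaf t then t' else t)"

text \<open>The special rule for an odd number of children is the case of exactly three remaining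
  children, as each recursive call handles one pair.\<close>

fun hmerge_children :: "('a part \<times> 'f aux_tree) list \<Rightarrow>
    (('a part \<times> bool) \<times> 'f aux_tree) list" where
  "hmerge_children [x, y, z] =
     (if is_leaf (snd x) \<or> is_leaf (snd y) then [hmerge x y, keep z]
      else if is_leaf (snd z) then [keep x, hmerge y z]
      else [keep x, keep y, keep z])"
| "hmerge_children (x # y # zs) =
     (if is_leaf (snd x) \<or> is_leaf (snd y) then hmerge x y # hmerge_children zs
      else keep x # keep y # hmerge_children zs)"
| "hmerge_children zs = map keep zs"

text \<open>Horizontal merges do not change which of the remaining nodes are leaves, so the subtrees
  may be treated before the children of the root are merged.\<close>

fun horizontal_step :: "'a part aux_tree \<Rightarrow> ('a part \<times> bool) aux_tree" where
  "horizontal_step (Aux es) =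
     Aux (hmerge_children (map (\<lambda>(e, t). (e, horizontal_step t)) es))"

section \<open>Step 2: vertical merges\<close>

text \<open>The maximal path that starts downwards with the edge \<open>e\<close> to the root of \<open>t\<close>: its edges
  from top to bottom, and the subtree rooted at its lowest node.\<close>

fun path_from :: "'e \<Rightarrow> 'e aux_tree \<Rightarrow> 'e list \<times> 'e aux_tree" where
  "path_from e (Aux [(e', t)]) = (let (es, s) = path_from e' t in (e # es, s))"
| "path_from e t = ([e], t)"

text \<open>The upper edge of a pair is the first argument of the merge, since its cluster is the first
  in preorder.\<close>

fun vmerge_pairs :: "'a part list \<Rightarrow> 'a part list" where
  "vmerge_pairs (e # e' # es) = merge_part e e' # vmerge_pairs es"
| "vmerge_pairs es = es"

text \<open>Edges are listed from top to bottom, so that for a path with nodes \<open>v\<^sub>1, \<dots>, v\<^sub>p\<close>, numbered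
  upwards, the list is \<open>e\<^sub>p\<^sub>-\<^sub>1, \<dots>, e\<^sub>1\<close>. It has odd length iff \<open>p\<close> is even.\<close>

definition vmerge_path :: "('a part \<times> bool) list \<Rightarrow> 'a part list" where
  "vmerge_path es =
     (let ds = map fst es in
      if odd (length es) then take 1 ds @ vmerge_pairs (drop 1 ds)
      else if snd (hd es) then take 2 ds @ vmerge_pairs (drop 2 ds)
      else vmerge_pairs ds)"

text \<open>The list of edges is nonempty in all uses.\<close>

fun attach_path :: "'e list \<Rightarrow> 'e aux_tree \<Rightarrow> 'e \<times> 'e aux_tree" where
  "attach_path [e] t = (e, t)"
| "attach_path (e # es) t = (e, Aux [attach_path es t])"

lemma size_path_from: "size (snd (path_from e t)) \<le> size t"
  by (induction e t rule: path_from.induct) (auto split: prod.splits)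

function vertical_step :: "('a part \<times> bool) aux_tree \<Rightarrow> 'a part aux_tree" where
  "vertical_step (Aux es) =
     Aux (map (\<lambda>(e, t). attach_path (vmerge_path (fst (path_from e t)))
                                    (vertical_step (snd (path_from e t)))) es)"
  by pat_completeness auto
termination
proof (relation "measure size", goal_cases)
  case (2 es x e t)
  have "size t < size_list (size_prod (\<lambda>_. 0) size) es + 1"
    using 2 by (auto simp: less_Suc_eq_le intro!: size_list_estimation')
  then show ?case using size_path_from[of e t] by simp
qed simp

section \<open>Each iteration decreases the number of edges\<close>

definition edge_sum :: "('e \<times> 'f aux_tree) list \<Rightarrow> nat" where
  "edge_sum es = sum_list (map (\<lambda>x. Suc (n_edges (snd x))) es)"

lemma edge_sum_simps [simp]:
  "edge_sum [] = 0"
  "edge_sum (x # xs) = Suc (n_edges (snd x)) + edge_sum xs"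
  by (simp_all add: edge_sum_def)

lemma n_edges_Aux: "n_edges (Aux es) = edge_sum es"
proof -
  have "(\<lambda>(e, t). 1 + n_edges t) = (\<lambda>x :: 'a \<times> 'a aux_tree. Suc (n_edges (snd x)))"
    by (auto simp: fun_eq_iff)
  then show ?thesis by (simp only: n_edges.simps edge_sum_def)
qed

declare n_edges.simps [simp del] n_edges_Aux [simp]

lemma n_edges_leaf: "is_leaf t \<Longrightarrow> n_edges t = 0"
  by (cases t) (auto simp: is_leaf_def)

lemma snd_hmerge:
  "is_leaf (snd x) \<or> is_leaf (snd y) \<Longrightarrow>
   n_edges (snd (hmerge x y)) \<le> n_edges (snd x) + n_edges (snd y)"
  by (cases x; cases y) auto

lemma keep_simps: "snd (keep x) = snd x" "snd (fst (keep x)) = False"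
  by (cases x; simp)+

lemma edge_sum_map_keep: "edge_sum (map keep xs) = edge_sum xs"
  by (induction xs) (auto simp: keep_simps)

lemma edge_sum_hmerge_children:
  "edge_sum (hmerge_children xs) < edge_sum xs \<or>
   (hmerge_children xs = map keep xs \<and> (length xs \<ge> 2 \<longrightarrow> \<not> is_leaf (snd (hd xs))))"
proof (induction xs rule: hmerge_children.induct)
  case (1 x y z)
  show ?case
    using snd_hmerge[of x y] snd_hmerge[of y z] by (auto simp: keep_simps le_imp_less_Suc)
next
  case ("2_1" x y)
  show ?case
    using snd_hmerge[of x y] by (auto simp: keep_simps le_imp_less_Suc)
next
  case ("2_2" x y z z' zs)
  let ?zs = "z # z' # zs"
  show ?case
  proof (cases "is_leaf (snd x) \<or> is_leaf (snd y)")
    case True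
    have "edge_sum (hmerge_children ?zs) \<le> edge_sum ?zs"
      using "2_2.IH"(1)[OF True] edge_sum_map_keep[of ?zs] by (metis less_or_eq_imp_le)
    with True snd_hmerge[OF True]
    have "edge_sum (hmerge_children (x # y # ?zs)) < edge_sum (x # y # ?zs)"
      by (simp)
    then show ?thesis ..
  next
    case False
    have "edge_sum (hmerge_children ?zs) < edge_sum ?zs \<or> hmerge_children ?zs = map keep ?zs"
      using "2_2.IH"(2)[OF False] by blast
    with False show ?thesis
      by (auto simp: keep_simps)
  qed
qed simp_all

text \<open>Only a consequence of the absence of horizontal merges, sufficient for a vertical merge to exist.\<close>

fun unmerged :: "('e \<times> bool) aux_tree \<Rightarrow> bool" where
  "unmerged (Aux es) \<longleftrightarrow>
     (\<forall>(e, t) \<in> set es. \<not> snd e \<and> unmerged t) \<and>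
     (length es \<ge> 2 \<longrightarrow> \<not> is_leaf (snd (hd es)))"

lemma horizontal_step_cases:
  "n_edges (horizontal_step t) < n_edges t \<or>
   n_edges (horizontal_step t) = n_edges t \<and> unmerged (horizontal_step t)"
proof (induction t)
  case (Aux es)
  let ?f = "\<lambda>(e, t). (e, horizontal_step t)"
  let ?es = "map ?f es"
  have IH: "n_edges (horizontal_step t) < n_edges t \<or>
      n_edges (horizontal_step t) = n_edges t \<and> unmerged (horizontal_step t)"
    if "(e, t) \<in> set es" for e t
    using Aux.IH[of "(e, t)" t] that by auto
  have sum: "edge_sum ?es < edge_sum es \<or>
      edge_sum ?es = edge_sum es \<and> (\<forall>(e, t) \<in> set ?es. unmerged t)"
    using IH
  proof (induction es)
    case (Cons x xs)
    obtain e t where x: "x = (e, t)" by fastforce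
    have "edge_sum (map ?f xs) < edge_sum xs \<or>
        edge_sum (map ?f xs) = edge_sum xs \<and> (\<forall>(e, t) \<in> set (map ?f xs). unmerged t)"
      using Cons.prems by (intro Cons.IH) auto
    moreover have "n_edges (horizontal_step t) < n_edges t \<or>
        n_edges (horizontal_step t) = n_edges t \<and> unmerged (horizontal_step t)"
      using Cons.prems[of e t] x by simp
    ultimately show ?case by (auto simp: x)
  qed simp
  have edges: "n_edges (horizontal_step (Aux es)) = edge_sum (hmerge_children ?es)"
    "n_edges (Aux es) = edge_sum es"
    by simp_all
  from edge_sum_hmerge_children[of ?es] show ?case
  proof (elim disjE conjE)
    assume "edge_sum (hmerge_children ?es) < edge_sum ?es"
    then show ?thesis using sum edges by linarith
  next
    assume k: "hmerge_children ?es = map keep ?es"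
      and hd: "length ?es \<ge> 2 \<longrightarrow> \<not> is_leaf (snd (hd ?es))"
    have e: "edge_sum (hmerge_children ?es) = edge_sum ?es"
      by (simp only: k edge_sum_map_keep)
    have "unmerged (horizontal_step (Aux es))" if "\<forall>(e, t) \<in> set ?es. unmerged t"
    proof -
      have "snd (hd (map keep ?es)) = snd (hd ?es)" if "length es \<ge> 2"
        using that by (cases es) (auto simp: keep_simps)
      then show ?thesis
        using hd \<open>\<forall>(e, t) \<in> set ?es. unmerged t\<close>
        by (auto simp: k split_beta keep_simps simp del: list.map_comp)
    qed
    then show ?thesis using sum edges e by linarith
  qed
qed

lemma length_vmerge_pairs: "length (vmerge_pairs es) = (length es + 1) div 2"
  by (induction es rule: vmerge_pairs.induct) auto

lemma length_vmerge_path: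
  assumes "es \<noteq> []"
  shows "vmerge_path es \<noteq> []" "length (vmerge_path es) \<le> length es"
    "length es \<ge> 2 \<Longrightarrow> \<not> snd (hd es) \<Longrightarrow> length (vmerge_path es) < length es"
proof -
  have l: "length es > 0" using assms by simp
  have "0 < length (vmerge_path es)"
    using l by (cases es; cases "tl es") (auto simp: vmerge_path_def Let_def length_vmerge_pairs)
  then show "vmerge_path es \<noteq> []" by auto
  show "length (vmerge_path es) \<le> length es"
    using l by (auto simp: vmerge_path_def Let_def length_vmerge_pairs min_def)
  show "length (vmerge_path es) < length es" if "length es \<ge> 2" "\<not> snd (hd es)"
  proof (cases "length es = 2")
    case False
    then show ?thesis
      using l that by (auto simp: vmerge_path_def Let_def length_vmerge_pairs min_def)
  qed (use that in \<open>auto simp: vmerge_path_def Let_def length_vmerge_pairs\<close>)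
qed

lemma n_edges_attach_path:
  "es \<noteq> [] \<Longrightarrow> Suc (n_edges (snd (attach_path es t))) = length es + n_edges t"
  by (induction es t rule: attach_path.induct) auto

lemma path_from_nonempty: "fst (path_from e t) \<noteq> []" "hd (fst (path_from e t)) = e"
  by (induction e t rule: path_from.induct) (auto split: prod.splits)

lemma edge_sum_path_from:
  "length (fst (path_from e t)) + n_edges (snd (path_from e t)) = 1 + n_edges t"
  by (induction e t rule: path_from.induct) (auto split: prod.splits)

lemma path_from_single:
  "length (edges t) = 1 \<Longrightarrow> length (fst (path_from e t)) \<ge> 2"
proof (induction e t rule: path_from.induct)
  case (1 e e' t)
  then show ?case using path_from_nonempty(1)[of e' t] by (auto split: prod.splits simp: Suc_le_eq)
qed auto

lemma path_from_branching: "length (edges t) \<noteq> 1 \<Longrightarrow> path_from e t = ([e], t)"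
  by (cases "(e, t)" rule: path_from.cases) auto

lemma vertical_step_edge:
  assumes "n_edges (vertical_step (snd (path_from e t))) \<le> n_edges (snd (path_from e t))"
  shows "n_edges (snd (attach_path (vmerge_path (fst (path_from e t)))
             (vertical_step (snd (path_from e t))))) \<le> n_edges t"
    and "\<not> snd e \<Longrightarrow> length (edges t) = 1 \<Longrightarrow>
         n_edges (snd (attach_path (vmerge_path (fst (path_from e t)))
             (vertical_step (snd (path_from e t))))) < n_edges t"
proof -
  let ?es = "fst (path_from e t)"
  note v = length_vmerge_path[OF path_from_nonempty(1)[of e t]]
  note s = n_edges_attach_path[OF v(1), of "vertical_step (snd (path_from e t))"]
    edge_sum_path_from[of e t] assms
  show "n_edges (snd (attach_path (vmerge_path (fst (path_from e t)))
             (vertical_step (snd (path_from e t))))) \<le> n_edges t"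
    using s v(2) by linarith
  assume "\<not> snd e" "length (edges t) = 1"
  then have "length (vmerge_path ?es) < length ?es"
    using v(3) path_from_single[of t e] path_from_nonempty(2)[of e t] by metis
  then show "n_edges (snd (attach_path (vmerge_path (fst (path_from e t)))
             (vertical_step (snd (path_from e t))))) < n_edges t"
    using s by linarith
qed

lemma n_edges_vertical_step_le: "n_edges (vertical_step t) \<le> n_edges t"
proof (induction t rule: vertical_step.induct)
  case (1 es)
  let ?f = "\<lambda>(e, t). attach_path (vmerge_path (fst (path_from e t)))
                                  (vertical_step (snd (path_from e t)))"
  have "n_edges (snd (?f x)) \<le> n_edges (snd x)" if "x \<in> set es" for x
  proof -
    obtain e t where x: "x = (e, t)" by fastforce
    show ?thesis
      using vertical_step_edge(1)[OF 1[OF that x[symmetric]]] by (simp add: x)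
  qed
  then have "edge_sum (map ?f es) \<le> edge_sum es"
    by (induction es) (auto simp: add_mono)
  then show ?case by simp
qed

lemma n_edges_vertical_step_less:
  "unmerged t \<Longrightarrow> n_edges t > 1 \<Longrightarrow> n_edges (vertical_step t) < n_edges t"
proof (induction t)
  case (Aux es)
  let ?f = "\<lambda>(e, t). attach_path (vmerge_path (fst (path_from e t)))
                                  (vertical_step (snd (path_from e t)))"
  obtain e t xs where es: "es = (e, t) # xs"
    using Aux.prems by (cases es) auto
  have t: "unmerged t" "\<not> snd e" using Aux.prems es by auto
  have "\<not> is_leaf t"
  proof (cases "xs = []")
    case True
    then show ?thesis using Aux.prems es n_edges_leaf[of t] by auto
  next
    case False
    then show ?thesis using Aux.prems es by (cases xs) auto
  qed
  have "n_edges (snd (?f (e, t))) < n_edges t"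
  proof (cases "length (edges t) = 1")
    case True
    then show ?thesis
      using vertical_step_edge(2)[OF n_edges_vertical_step_le t(2)] by simp
  next
    case False
    then have "length (edges t) > 1"
      using \<open>\<not> is_leaf t\<close> by (cases "edges t") (auto simp: is_leaf_def)
    then have "n_edges t > 1"
      by (cases t; cases "edges t"; cases "tl (edges t)") auto
    then have "n_edges (vertical_step t) < n_edges t"
      using Aux.IH[of "(e, t)" t] t es by auto
    then show ?thesis
      using False by (simp add: path_from_branching vmerge_path_def)
  qed
  moreover have "edge_sum (map ?f xs) \<le> edge_sum xs"
    using n_edges_vertical_step_le[of "Aux xs"] by simp
  ultimately show ?case by (simp add: es)
qed

lemma n_edges_iteration_less:
  assumes "n_edges t > 1"
  shows "n_edges (vertical_step (horizontal_step t)) < n_edges t"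
  using horizontal_step_cases[of t] n_edges_vertical_step_le[of "horizontal_step t"]
    n_edges_vertical_step_less[of "horizontal_step t"] assms by linarith

section \<open>The top tree of the greedy construction and its minimal DAG\<close>

function greedy :: "'a part aux_tree \<Rightarrow> 'a part aux_tree" where
  "greedy t = (if n_edges t > 1 then greedy (vertical_step (horizontal_step t)) else t)"
  by pat_completeness auto
termination
  by (relation "measure n_edges") (auto simp: n_edges_iteration_less)

declare greedy.simps [simp del]

text \<open>A tree with at least two nodes is reduced to a single edge, whose data is the top tree.
  A tree without edges has no top tree.\<close>

definition top_tree_of :: "'a tree \<Rightarrow> 'a top_tree" where
  "top_tree_of T = fst (fst (hd (edges (greedy (initial_aux [] T)))))"

fun subtrees :: "'a top_tree \<Rightarrow> 'a top_tree set" where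
  "subtrees (Edge a b) = {Edge a b}"
| "subtrees (Merge m s t) = insert (Merge m s t) (subtrees s \<union> subtrees t)"

datatype side = Left_child | Right_child

text \<open>In the minimal DAG, each distinct rooted subtree is one vertex. The edges to the two children
  of an internal vertex are different, even if the two children are represented by
  the same vertex.\<close>

definition dag_vertices :: "'a top_tree \<Rightarrow> 'a top_tree set" where
  "dag_vertices \<T> = subtrees \<T>"

definition dag_edges :: "'a top_tree \<Rightarrow> ('a top_tree \<times> side \<times> 'a top_tree) set" where
  "dag_edges \<T> =
     {(Merge m s t, Left_child, s) | m s t. Merge m s t \<in> dag_vertices \<T>} \<union>
     {(Merge m s t, Right_child, t) | m s t. Merge m s t \<in> dag_vertices \<T>}"

definition top_dag_size :: "'a tree \<Rightarrow> nat" where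
  "top_dag_size T = card (dag_vertices (top_tree_of T)) + card (dag_edges (top_tree_of T))"

end

theory Submission
  imports Defs "HOL-Library.Multiset"
begin

text \<open>
  Let \<open>n\<close> be the number of nodes of \<open>T\<close>, let \<open>\<sigma>\<close> be the size of the alphabet, and let \<open>K\<close> be about
  \<open>(log\<^sub>\<sigma> n) / 16\<close>. Since there are at most \<open>(\<sigma>\<^sup>2 + 6)\<^sup>2\<^sup>K \<le> \<sigma>\<^sup>8\<^sup>K \<le> \<surd>n\<close> top trees with at most \<open>K\<close> leaves,
  it suffices to count the clusters with more than \<open>K\<close> edges. The clusters present after any one
  step are edge-disjoint, so if there are \<open>m\<close> of them, at most \<open>min m (n/K) \<le> \<surd>(m n/K)\<close> are large.
  An iteration shrinks \<open>m\<close> at least by the factor 8/9, and summing the geometric series gives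
  \<open>O(n/\<surd>K)\<close> large clusters, which is even better than the exponent 0.19.

  For the factor 8/9, let \<open>m\<close>, \<open>m'\<close>, \<open>m''\<close> be the numbers of edges before the iteration, after Step 1
  and after Step 2, and \<open>H = m - m'\<close>. In the tree after Step 1, let \<open>\<ell>\<close> be the number of leaves,
  \<open>u\<close> the number of nodes with one child and \<open>q = m' - u\<close> the number of edges below
  branching nodes. Step 1 merges enough leaves that \<open>\<ell> \<le> 2 H + u\<close>; moreover \<open>q + 2 \<le> 2 \<ell>\<close>, and
  halving each of the at most \<open>q + 1\<close> maximal paths, except for top edges created in Step 1,
  gives \<open>2 m'' \<le> m' + q + 1 + H\<close>. Together
  \<open>8 m'' \<le> 7 m + 1\<close>, and \<open>m'' \<le> m - 1\<close>.
\<close>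

section \<open>The number of edges shrinks geometrically\<close>

text \<open>The next four functions formalise \<ell>, u, q and H of the outline; each edge counted
  in q starts a maximal path.\<close>

fun n_leaves :: "'e aux_tree \<Rightarrow> nat" where
  "n_leaves (Aux es) = (if es = [] then 1 else (\<Sum>(e, t)\<leftarrow>es. n_leaves t))"

fun n_unary :: "'e aux_tree \<Rightarrow> nat" where
  "n_unary (Aux es) = of_bool (length es = 1) + (\<Sum>(e, t)\<leftarrow>es. n_unary t)"

fun n_branch_edges :: "'e aux_tree \<Rightarrow> nat" where
  "n_branch_edges (Aux es) =
     (if length es = 1 then 0 else length es) + (\<Sum>(e, t)\<leftarrow>es. n_branch_edges t)"

fun n_merged :: "('e \<times> bool) aux_tree \<Rightarrow> nat" where
  "n_merged (Aux es) = (\<Sum>(e, t)\<leftarrow>es. of_bool (snd e) + n_merged t)"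

lemma n_edges_eq: "n_edges t = n_branch_edges t + n_unary t"
proof (induction t)
  case (Aux es)
  have "n_edges t = n_branch_edges t + n_unary t" if "(e, t) \<in> set es" for e t
    using Aux.IH[of "(e, t)" t] that by auto
  then have "edge_sum es = length es + (\<Sum>(e, t)\<leftarrow>es. n_branch_edges t) + (\<Sum>(e, t)\<leftarrow>es. n_unary t)"
    by (induction es) force+
  then show ?case by auto
qed

text \<open>Contracting the unary nodes leaves a tree whose inner nodes have at least two children;
  with \<ell> leaves it has at most 2 \<ell> - 2 edges.\<close>

lemma n_branch_edges_le: "n_branch_edges t + 2 \<le> 2 * n_leaves t"
proof (induction t)
  case (Aux es)
  have "n_branch_edges t + 2 \<le> 2 * n_leaves t" if "(e, t) \<in> set es" for e t
    using Aux.IH[of "(e, t)" t] that by auto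
  then have *: "(\<Sum>(e, t)\<leftarrow>es. n_branch_edges t) + 2 * length es \<le> 2 * (\<Sum>(e, t)\<leftarrow>es. n_leaves t)"
    by (induction es) force+
  consider "es = []" | "length es = 1" | "length es \<ge> 2" by (cases es; cases "tl es") auto
  then show ?case using * by cases auto
qed

section \<open>Horizontal merges: leaves are paid for by merges\<close>

lemma n_leaves_leaf: "is_leaf t \<Longrightarrow> n_leaves t = 1"
  by (cases t) (simp add: is_leaf_def)

lemma n_merged_leaf: "is_leaf t \<Longrightarrow> n_merged t = 0"
  by (cases t; simp add: is_leaf_def)+

text \<open>The only leaf child that can stay unmerged is the last of an odd number; the pair before
  it was merged, and the credit 2 of that merge pays for both. A lone leaf child cannot be paid this
  way, hence \<open>length xs \<ge> 2\<close>.\<close>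

lemma n_leaves_hmerge_children:
  assumes "\<And>e t. (e, t) \<in> set xs \<Longrightarrow> \<not> is_leaf t \<Longrightarrow> n_leaves t \<le> 2 * n_merged t + n_unary t"
    and "length xs \<ge> 2"
  shows "(\<Sum>(e, t)\<leftarrow>hmerge_children xs. n_leaves t) \<le>
         (\<Sum>(e, t)\<leftarrow>hmerge_children xs. 2 * (of_bool (snd e) + n_merged t) + n_unary t)"
  using assms
proof (induction xs rule: hmerge_children.induct)
  case (1 x y z)
  obtain e t e' t' e'' t'' where [simp]: "x = (e, t)" "y = (e', t')" "z = (e'', t'')"
    by (metis surj_pair)
  show ?case
    using "1.prems"(1)[of e t] "1.prems"(1)[of e' t'] "1.prems"(1)[of e'' t'']
      n_leaves_leaf[of t] n_leaves_leaf[of t'] n_leaves_leaf[of t'']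
    by (cases "is_leaf t"; cases "is_leaf t'"; cases "is_leaf t''") auto
next
  case ("2_1" x y)
  obtain e t e' t' where [simp]: "x = (e, t)" "y = (e', t')"
    by (metis surj_pair)
  show ?case
    using "2_1.prems"(1)[of e t] "2_1.prems"(1)[of e' t']
      n_leaves_leaf[of t] n_leaves_leaf[of t']
    by (cases "is_leaf t"; cases "is_leaf t'") auto
next
  case ("2_2" x y v va vb)
  obtain e t e' t' where [simp]: "x = (e, t)" "y = (e', t')"
    by (metis surj_pair)
  have "(\<Sum>(e, t)\<leftarrow>hmerge_children (v # va # vb). n_leaves t) \<le>
         (\<Sum>(e, t)\<leftarrow>hmerge_children (v # va # vb). 2 * (of_bool (snd e) + n_merged t) + n_unary t)"
    using "2_2.IH" "2_2.prems"(1)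
    by (cases "is_leaf (snd x) \<or> is_leaf (snd y)") (simp_all del: hmerge_children.simps, blast+)
  then show ?case
    using "2_2.prems"(1)[of e t] "2_2.prems"(1)[of e' t']
      n_leaves_leaf[of t] n_leaves_leaf[of t']
    by (cases "is_leaf t"; cases "is_leaf t'") auto
qed auto

lemma edge_sum_hmerge_children_merged:
  "edge_sum (hmerge_children xs) + (\<Sum>(e, t)\<leftarrow>hmerge_children xs. of_bool (snd e)) = edge_sum xs"
proof (induction xs rule: hmerge_children.induct)
  case (1 x y z)
  then show ?case by (cases x; cases y; cases z) (auto simp: n_edges_leaf)
next
  case ("2_1" x y)
  then show ?case by (cases x; cases y) (auto simp: n_edges_leaf)
next
  case ("2_2" x y v va vb)
  then show ?case by (cases x; cases y) (auto simp: n_edges_leaf)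
qed (auto split: prod.splits)

text \<open>A merge discards one of the two subtrees, and that one is a leaf. This carries sums over
  the levels below past the merges at a node.\<close>

lemma sum_hmerge_children:
  fixes f :: "'f aux_tree \<Rightarrow> 'm :: comm_monoid_add"
  assumes "\<And>t. is_leaf t \<Longrightarrow> f t = 0"
  shows "(\<Sum>(e, t)\<leftarrow>hmerge_children xs. f t) = (\<Sum>(e, t)\<leftarrow>xs. f t)"
proof (induction xs rule: hmerge_children.induct)
  case (1 x y z)
  then show ?case by (cases x; cases y; cases z) (auto simp: assms add_ac)
next
  case ("2_1" x y)
  then show ?case by (cases x; cases y) (auto simp: assms)
next
  case ("2_2" x y v va vb)
  then show ?case by (cases x; cases y) (auto simp: assms)
qed (auto split: prod.splits)

lemma horizontal_step_leaf_iff: "is_leaf (horizontal_step t) \<longleftrightarrow> is_leaf t"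
proof (cases t)
  case (Aux es)
  have "hmerge_children xs = [] \<longleftrightarrow> xs = []" for xs :: "('a part \<times> ('a part \<times> bool) aux_tree) list"
    by (cases xs rule: hmerge_children.cases) auto
  then show ?thesis using Aux by (simp add: is_leaf_def)
qed

lemma n_edges_horizontal_step:
  "n_edges (horizontal_step t) + n_merged (horizontal_step t) = n_edges t"
proof (induction t)
  case (Aux es)
  let ?xs = "map (\<lambda>(e, t). (e, horizontal_step t)) es"
  have "n_edges (horizontal_step t) + n_merged (horizontal_step t) = n_edges t"
    if "(e, t) \<in> set es" for e t
    using Aux.IH[of "(e, t)" t] that by auto
  then have "edge_sum ?xs + (\<Sum>(e, t)\<leftarrow>?xs. n_merged t) = edge_sum es"
    by (induction es) force+
  then show ?case
    using edge_sum_hmerge_children_merged[of ?xs]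
      sum_hmerge_children[where f = n_merged and xs = ?xs, OF n_merged_leaf]
    by (simp add: case_prod_unfold comp_def sum_list_addf)
qed

lemma n_leaves_horizontal_step:
  "\<not> is_leaf t \<Longrightarrow>
   n_leaves (horizontal_step t) \<le> 2 * n_merged (horizontal_step t) + n_unary (horizontal_step t)"
proof (induction t)
  case (Aux es)
  let ?xs = "map (\<lambda>(e, t). (e, horizontal_step t)) es"
  have *: "n_leaves t \<le> 2 * n_merged t + n_unary t" if "(e, t) \<in> set ?xs" "\<not> is_leaf t" for e t
    using Aux.IH that by (fastforce simp: horizontal_step_leaf_iff)
  show ?case
  proof (cases "length es \<ge> 2")
    case True
    then have "hmerge_children ?xs \<noteq> []"
      using horizontal_step_leaf_iff[of "Aux es"] by (auto simp: is_leaf_def)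
    moreover have "(\<Sum>(e, t)\<leftarrow>hmerge_children ?xs. n_leaves t) \<le>
        (\<Sum>(e, t)\<leftarrow>hmerge_children ?xs. 2 * (of_bool (snd e) + n_merged t) + n_unary t)"
      using True by (intro n_leaves_hmerge_children *) auto
    ultimately show ?thesis
      by (simp add: case_prod_unfold comp_def sum_list_addf flip: sum_list_const_mult)
  next
    case False
    then obtain e t where [simp]: "es = [(e, t)]"
      using Aux.prems by (cases es; cases "tl es") (auto simp: is_leaf_def)
    \<comment> \<open>The parent is unary, which pays for the child if that is a leaf.\<close>
    show ?thesis
      using *[of e "horizontal_step t"] n_leaves_leaf[of "horizontal_step t"]
      by (cases "is_leaf (horizontal_step t)") auto
  qed
qed

section \<open>Vertical merges: maximal paths are halved\<close>

text \<open>The summand 1 is the spare edge of a path of odd length; a top edge created in Step 1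
  leaves two spare edges on a path of even length.\<close>

lemma length_vmerge_path_le:
  "es \<noteq> [] \<Longrightarrow> 2 * length (vmerge_path es) \<le> length es + 1 + of_bool (snd (hd es))"
  by (cases "length es") (auto simp: vmerge_path_def Let_def length_vmerge_pairs)

text \<open>The path passes only through unary nodes, so it uses up no edge below a branching node
  of \<open>t\<close>, and being maximal it does not end in a unary node.\<close>

lemma path_from_end:
  "n_branch_edges (snd (path_from e t)) = n_branch_edges t"
  "n_merged (snd (path_from e t)) \<le> n_merged t"
  "length (edges (snd (path_from e t))) \<noteq> 1"
  by (induction e t rule: path_from.induct) (auto split: prod.splits)

text \<open>This sums \<open>length_vmerge_path_le\<close> over the maximal paths: each starts at an
  edge below a branching node or at the only edge of a unary root, which the last term accounts
  for.\<close>

lemma n_edges_vertical_step: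
  "2 * n_edges (vertical_step t) \<le> n_edges t + n_branch_edges t + n_merged t + of_bool (length (edges t) = 1)"
proof (induction t rule: vertical_step.induct)
  case (1 es)
  let ?f = "\<lambda>(e, t). attach_path (vmerge_path (fst (path_from e t)))
                                  (vertical_step (snd (path_from e t)))"
  have "2 * Suc (n_edges (snd (?f (e, t)))) \<le>
        Suc (n_edges t) + Suc (n_branch_edges t) + of_bool (snd e) + n_merged t"
    if "(e, t) \<in> set es" for e t
    using 1[OF that refl] path_from_end[of e t] edge_sum_path_from[of e t]
      length_vmerge_path_le[OF path_from_nonempty(1)[of e t]] path_from_nonempty(2)[of e t]
      n_edges_attach_path[OF length_vmerge_path(1)[OF path_from_nonempty(1)[of e t]],
        of "vertical_step (snd (path_from e t))"]
    by simp
  then have "2 * edge_sum (map ?f es) \<le>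
     edge_sum es + (length es + (\<Sum>(e, t)\<leftarrow>es. n_branch_edges t)) + (\<Sum>(e, t)\<leftarrow>es. of_bool (snd e) + n_merged t)"
  proof (induction es)
    case (Cons x es)
    obtain e t where x: "x = (e, t)" by fastforce
    show ?case
      using Cons.IH[OF Cons.prems] Cons.prems[of e t] by (simp add: x)
  qed simp
  then show ?case by (auto)
qed

lemma n_edges_iteration:
  assumes "n_edges t > 1"
  shows "9 * n_edges (vertical_step (horizontal_step t)) \<le> 8 * n_edges t"
proof -
  let ?h = "horizontal_step t"
  have "\<not> is_leaf t" using assms n_edges_leaf[of t] by auto
  note n_leaves_horizontal_step[OF this]
  moreover note n_edges_horizontal_step[of t] n_edges_eq[of ?h] n_branch_edges_le[of ?h]
     n_edges_vertical_step_le[of ?h] n_edges_iteration_less[OF assms]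
  moreover have "2 * n_edges (vertical_step ?h) \<le> n_edges ?h + n_branch_edges ?h + n_merged ?h + 1"
    using n_edges_vertical_step[of ?h] by (simp add: of_bool_def split: if_splits)
  \<comment> \<open>With m'' \<le> m' the inequalities give 3 q \<le> 4 m - 2 m'' - 2, hence 8 m''
    \<le> 7 m + 1; adding m'' \<le> m - 1 yields the factor 8/9.\<close>
  ultimately show ?thesis by linarith
qed

section \<open>Top trees along the iteration\<close>

text \<open>The multiset of the roots of the partial top tree before and after one of the two steps.\<close>

inductive coarsening :: "'a top_tree multiset \<Rightarrow> 'a top_tree multiset \<Rightarrow> bool" where
  empty: "coarsening {#} {#}"
| keep: "coarsening M N \<Longrightarrow> coarsening (add_mset s M) (add_mset s N)"
| merge: "coarsening M N \<Longrightarrow> coarsening (add_mset s (add_mset t M)) (add_mset (Merge m s t) N)"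

lemma coarsening_add:
  "coarsening M N \<Longrightarrow> coarsening M' N' \<Longrightarrow> coarsening (M + M') (N + N')"
  by (induction rule: coarsening.induct) (auto intro: coarsening.intros)

lemma coarsening_refl: "coarsening M M"
  by (induction M) (auto intro: coarsening.intros)

text \<open>The leaves of a top tree are the edges of its cluster, so this is the size of the
  cluster.\<close>

fun n_tree_edges :: "'a top_tree \<Rightarrow> nat" where
  "n_tree_edges (Edge a b) = 1"
| "n_tree_edges (Merge m s t) = n_tree_edges s + n_tree_edges t"

definition all_subtrees :: "'a top_tree multiset \<Rightarrow> 'a top_tree set" where
  "all_subtrees M = (\<Union>s \<in> set_mset M. subtrees s)"

text \<open>Merging adds the edge counts, so the total is the same at all times; this limits the
  number of large roots.\<close>

lemma coarsening_n_tree_edges: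
  "coarsening M N \<Longrightarrow> sum_mset (image_mset n_tree_edges N) = sum_mset (image_mset n_tree_edges M)"
  by (induction rule: coarsening.induct) auto

lemma coarsening_labels:
  "coarsening M N \<Longrightarrow> (\<Union>s \<in> set_mset N. set_top_tree s) = (\<Union>s \<in> set_mset M. set_top_tree s)"
  by (induction rule: coarsening.induct) auto

text \<open>A merge creates one new subtree, the merged tree itself, and that is a root in
  \<open>N\<close>; so counting roots after each step captures all subtrees that arise.\<close>

lemma coarsening_subtrees:
  "coarsening M N \<Longrightarrow> all_subtrees N \<subseteq> all_subtrees M \<union> set_mset N"
  by (induction rule: coarsening.induct) (auto simp: all_subtrees_def)

lemma coarsening_nonempty: "coarsening M N \<Longrightarrow> M \<noteq> {#} \<Longrightarrow> N \<noteq> {#}"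
  by (induction rule: coarsening.induct) auto

section \<open>Both greedy steps are coarsenings\<close>

fun edge_data :: "'e aux_tree \<Rightarrow> 'e multiset" where
  "edge_data (Aux es) = (\<Sum>(e, t)\<leftarrow>es. add_mset e (edge_data t))"

abbreviation tops :: "'a part aux_tree \<Rightarrow> 'a top_tree multiset" where
  "tops t \<equiv> image_mset fst (edge_data t)"

abbreviation flagged_tops :: "('a part \<times> bool) aux_tree \<Rightarrow> 'a top_tree multiset" where
  "flagged_tops t \<equiv> image_mset (fst \<circ> fst) (edge_data t)"

lemma size_edge_data: "size (edge_data t) = n_edges t"
proof (induction t)
  case (Aux es)
  have "size (edge_data t) = n_edges t" if "(e, t) \<in> set es" for e t
    using Aux.IH[of "(e, t)" t] that by auto
  then have "size (edge_data (Aux es)) = edge_sum es"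
    by (induction es) force+
  then show ?case by simp
qed

lemma edge_data_leaf: "is_leaf t \<Longrightarrow> edge_data t = {#}"
  by (cases t) (simp add: is_leaf_def)

lemma coarsening_list:
  assumes "\<And>x. x \<in> set xs \<Longrightarrow> coarsening (f x) (g x)"
  shows "coarsening (\<Sum>x\<leftarrow>xs. f x) (\<Sum>x\<leftarrow>xs. g x)"
  using assms by (induction xs) (auto intro: coarsening_add coarsening.empty)

lemma image_mset_sum_list: "image_mset f (\<Sum>x\<leftarrow>xs. g x) = (\<Sum>x\<leftarrow>xs. image_mset f (g x))"
  by (induction xs) auto

lemma coarsening_merge_part:
  "coarsening M N \<Longrightarrow>
   coarsening (add_mset (fst e) (add_mset (fst e') M)) (add_mset (fst (merge_part e e')) N)"
  by (cases e; cases e') (auto intro: coarsening.merge)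

lemma coarsening_hmerge_children:
  assumes hmerge: "\<And>x y. is_leaf (snd x) \<or> is_leaf (snd y) \<Longrightarrow> coarsening (f x + f y) (g (hmerge x y))"
    and keep: "\<And>x. coarsening (f x) (g (keep x))"
  shows "coarsening (\<Sum>x\<leftarrow>xs. f x) (\<Sum>x\<leftarrow>hmerge_children xs. g x)"
proof (induction xs rule: hmerge_children.induct)
  case (1 x y z)
  show ?case
    using coarsening_add[OF hmerge[of x y] keep[of z]] coarsening_add[OF keep[of x] hmerge[of y z]]
      coarsening_add[OF keep[of x] coarsening_add[OF keep[of y] keep[of z]]]
    by (simp add: add_ac)
next
  case ("2_1" x y)
  show ?case
    using hmerge[of x y] coarsening_add[OF keep[of x] keep[of y]] by (simp add: add_ac)
next
  case ("2_2" x y v va vb)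
  then have IH: "coarsening (\<Sum>x\<leftarrow>v # va # vb. f x) (\<Sum>x\<leftarrow>hmerge_children (v # va # vb). g x)"
    by blast
  show ?case
    using coarsening_add[OF hmerge[of x y] IH]
      coarsening_add[OF keep[of x] coarsening_add[OF keep[of y] IH]]
    by (simp add: add_ac)
qed (use keep in \<open>auto intro: coarsening.empty\<close>)

lemma image_mset_edge_data:
  "image_mset f (edge_data (Aux es)) =
     (\<Sum>x\<leftarrow>es. {#f (fst x)#}) + (\<Sum>(e, t)\<leftarrow>es. image_mset f (edge_data t))"
  by (induction es) auto

text \<open>Edges at the root are coarsened by \<open>coarsening_hmerge_children\<close>, those
  further down by induction; as merges discard only leaf subtrees, the two parts can be
  added.\<close>

lemma coarsening_horizontal_step: "coarsening (tops t) (flagged_tops (horizontal_step t))"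
proof (induction t)
  case (Aux es)
  let ?h = "\<lambda>(e, t). (e, horizontal_step t)"
  let ?xs = "map ?h es"
  have "coarsening (\<Sum>x\<leftarrow>?xs. {#fst (fst x)#}) (\<Sum>x\<leftarrow>hmerge_children ?xs. {#fst (fst (fst x))#})"
  proof (rule coarsening_hmerge_children)
    fix x y :: "'a part \<times> ('a part \<times> bool) aux_tree"
    assume "is_leaf (snd x) \<or> is_leaf (snd y)"
    moreover obtain s A t s' A' t' where "x = ((s, A), t)" "y = ((s', A'), t')"
      by (metis surj_pair)
    ultimately show "coarsening ({#fst (fst x)#} + {#fst (fst y)#}) {#fst (fst (fst (hmerge x y)))#}"
      using coarsening.merge[OF coarsening.empty, of s s'] by (auto simp: add_mset_commute[of s'])
  next
    show "coarsening {#fst (fst x)#} {#fst (fst (fst (keep x)))#}"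
      for x :: "'a part \<times> ('a part \<times> bool) aux_tree"
      by (cases x) (auto intro: coarsening_refl)
  qed
  moreover have "coarsening (\<Sum>(e, t)\<leftarrow>es. tops t) (\<Sum>(e, t)\<leftarrow>?xs. flagged_tops t)"
  proof -
    have "coarsening (tops (snd x)) (flagged_tops (horizontal_step (snd x)))" if "x \<in> set es" for x
      by (rule Aux.IH[OF that]) (cases x, simp)
    from coarsening_list[of es, OF this] show ?thesis
      by (simp only: case_prod_unfold map_map comp_def fst_conv snd_conv)
  qed
  moreover have "(\<Sum>(e, t)\<leftarrow>hmerge_children ?xs. flagged_tops t) = (\<Sum>(e, t)\<leftarrow>?xs. flagged_tops t)"
    by (rule sum_hmerge_children) (simp add: edge_data_leaf)
  moreover have "(\<Sum>x\<leftarrow>?xs. {#fst (fst x)#}) = (\<Sum>x\<leftarrow>es. {#fst (fst x)#})"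
    by (induction es) auto
  ultimately have "coarsening ((\<Sum>x\<leftarrow>es. {#fst (fst x)#}) + (\<Sum>(e, t)\<leftarrow>es. tops t))
      ((\<Sum>x\<leftarrow>hmerge_children ?xs. {#fst (fst (fst x))#}) +
       (\<Sum>(e, t)\<leftarrow>hmerge_children ?xs. flagged_tops t))"
    using coarsening_add by metis
  then show ?case
    unfolding horizontal_step.simps image_mset_edge_data comp_apply .
qed

lemma coarsening_vmerge_pairs:
  "coarsening (image_mset fst (mset es)) (image_mset fst (mset (vmerge_pairs es)))"
  by (induction es rule: vmerge_pairs.induct)
     (auto intro: coarsening_merge_part coarsening.intros)

lemma coarsening_vmerge_path:
  "coarsening (image_mset (fst \<circ> fst) (mset es)) (image_mset fst (mset (vmerge_path es)))"
proof -
  have "coarsening (image_mset fst (mset ds)) (image_mset fst (mset (take n ds @ vmerge_pairs (drop n ds))))"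
    for n and ds :: "'a part list"
  proof -
    have "image_mset fst (mset ds) = image_mset fst (mset (take n ds)) + image_mset fst (mset (drop n ds))"
      by (metis append_take_drop_id image_mset_union mset_append)
    then show ?thesis
      using coarsening_add[OF coarsening_refl coarsening_vmerge_pairs] by simp
  qed
  note * = this[of "map fst es"]
  \<comment> \<open>The branches of \<open>vmerge_path\<close> leave the top 1, 2 or 0 edges
    unpaired.\<close>
  show ?thesis
    using *[of 0] *[of 1] *[of 2]
    by (simp add: vmerge_path_def Let_def multiset.map_comp)
qed

lemma edge_data_path_from:
  "mset (fst (path_from e t)) + edge_data (snd (path_from e t)) = add_mset e (edge_data t)"
  by (induction e t rule: path_from.induct) (auto split: prod.splits)

lemma edge_data_attach_path:
  "es \<noteq> [] \<Longrightarrow>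
   add_mset (fst (attach_path es t)) (edge_data (snd (attach_path es t))) = mset es + edge_data t"
  by (induction es t rule: attach_path.induct) (auto simp: case_prod_unfold)

text \<open>An edge and the data below it split into its maximal path and the part below the end of
  the path; \<open>vmerge_path\<close> coarsens the first, the induction hypothesis the
  second.\<close>

lemma coarsening_vertical_step: "coarsening (flagged_tops t) (tops (vertical_step t))"
proof (induction t rule: vertical_step.induct)
  case (1 es)
  let ?f = "\<lambda>(e, t). attach_path (vmerge_path (fst (path_from e t)))
                                  (vertical_step (snd (path_from e t)))"
  have "coarsening (image_mset (fst \<circ> fst) (add_mset (fst x) (edge_data (snd x))))
          (image_mset fst (add_mset (fst (?f x)) (edge_data (snd (?f x)))))" if "x \<in> set es" for x
  proof -
    obtain e t where x: "x = (e, t)" by fastforce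
    have ne: "vmerge_path (fst (path_from e t)) \<noteq> []"
      by (intro length_vmerge_path path_from_nonempty)
    from coarsening_add[OF coarsening_vmerge_path 1[OF that x[symmetric]], of "fst (path_from e t)"]
    show ?thesis
      unfolding x fst_conv snd_conv case_prod_conv edge_data_attach_path[OF ne]
        edge_data_path_from[of e t, symmetric] image_mset_union .
  qed
  then show ?case
    by (simp add: image_mset_sum_list case_prod_unfold comp_def coarsening_list del: image_mset_add_mset)
qed

section \<open>Large subtrees\<close>

definition large_subtrees :: "nat \<Rightarrow> 'a top_tree multiset \<Rightarrow> 'a top_tree set" where
  "large_subtrees K M = {s \<in> all_subtrees M. n_tree_edges s > K}"

lemma finite_subtrees: "finite (subtrees s)"
  by (induction s) auto

lemma finite_large_subtrees: "finite (large_subtrees K M)"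
  by (simp add: large_subtrees_def all_subtrees_def finite_subtrees)

text \<open>Both \<open>size N\<close> and the number of edges divided by \<open>K\<close> bound the cardinality, hence so does
  their geometric mean, which sums to a geometric series over the iterations.\<close>

lemma card_large_le:
  assumes "K > 0"
  shows "real (card {s \<in> set_mset N. n_tree_edges s > K}) \<le>
         sqrt (size N) * sqrt (real (\<Sum>\<^sub># (image_mset n_tree_edges N)) / K)"
proof -
  let ?L = "filter_mset (\<lambda>s. n_tree_edges s > K) N"
  let ?c = "card {s \<in> set_mset N. n_tree_edges s > K}" and ?S = "\<Sum>\<^sub># (image_mset n_tree_edges N)"
  have "card (set_mset M) \<le> size M" for M :: "'a top_tree multiset"
    by (induction M) (auto simp: card_insert_if)
  from this[of ?L] have c: "?c \<le> size ?L" by simp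
  have "size ?L * K \<le> ?S"
    by (induction N) auto
  with c have "?c * K \<le> ?S" by (meson le_trans mult_le_mono1)
  then have "real ?c * real K \<le> real ?S"
    by (metis of_nat_le_iff of_nat_mult)
  then have 1: "real ?c \<le> real ?S / K"
    using assms by (subst pos_le_divide_eq) auto
  have "?c \<le> size N" using c size_filter_mset_lesseq le_trans by blast
  with 1 have "real ?c * real ?c \<le> size N * (real ?S / K)"
    by (intro mult_mono) auto
  then have "real ?c \<le> sqrt (size N * (real ?S / K))"
    by (intro real_le_rsqrt) (simp only: power2_eq_square)
  then show ?thesis by (simp only: real_sqrt_mult)
qed

lemma card_large_subtrees_coarsening:
  assumes "coarsening M N" "K > 0"
  shows "real (card (large_subtrees K N)) \<le> card (large_subtrees K M) +
           sqrt (size N) * sqrt (real (\<Sum>\<^sub># (image_mset n_tree_edges M)) / K)"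
proof -
  have "large_subtrees K N \<subseteq> large_subtrees K M \<union> {s \<in> set_mset N. n_tree_edges s > K}"
    using coarsening_subtrees[OF assms(1)] by (auto simp: large_subtrees_def)
  then have "card (large_subtrees K N) \<le> card (large_subtrees K M) + card {s \<in> set_mset N. n_tree_edges s > K}"
    by (intro order_trans[OF card_mono card_Un_le]) (auto simp: finite_large_subtrees)
  then show ?thesis
    using card_large_le[OF assms(2), of N] coarsening_n_tree_edges[OF assms(1)] by simp
qed

text \<open>With m edges before an iteration and X = sqrt (S / K), its two steps create at most 2
  sqrt m X large subtrees, and sqrt m shrinks by the factor 17/18. The constant solves c = 2 +
  (17/18) c, so c = 36.\<close>

lemma greedy_result:
  fixes t :: "'a part aux_tree"
  assumes "n_edges t \<ge> 1"
  shows "n_edges (greedy t) = 1 \<and>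
    \<Sum>\<^sub># (image_mset n_tree_edges (tops (greedy t))) = \<Sum>\<^sub># (image_mset n_tree_edges (tops t)) \<and>
    (\<Union>s \<in> set_mset (tops (greedy t)). set_top_tree s) = (\<Union>s \<in> set_mset (tops t). set_top_tree s) \<and>
    (K > 0 \<longrightarrow> real (card (large_subtrees K (tops (greedy t)))) \<le>
           card (large_subtrees K (tops t)) +
           36 * sqrt (n_edges t) * sqrt (real (\<Sum>\<^sub># (image_mset n_tree_edges (tops t))) / K))"
  using assms
proof (induction t rule: greedy.induct)
  case (1 t)
  let ?h = "horizontal_step t"
  let ?v = "vertical_step ?h"
  let ?S = "\<lambda>t. \<Sum>\<^sub># (image_mset n_tree_edges (tops t))"
  note h = coarsening_horizontal_step[of t] and v = coarsening_vertical_step[of ?h]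
  have S: "?S ?v = ?S t" "\<Sum>\<^sub># (image_mset n_tree_edges (flagged_tops ?h)) = ?S t"
    using coarsening_n_tree_edges[OF h] coarsening_n_tree_edges[OF v] by simp_all
  have L: "(\<Union>s \<in> set_mset (tops ?v). set_top_tree s) = (\<Union>s \<in> set_mset (tops t). set_top_tree s)"
    using coarsening_labels[OF h] coarsening_labels[OF v] by simp
  \<comment> \<open>Merging never removes the last cluster, so the induction hypothesis
    applies.\<close>
  have ne: "n_edges ?v \<ge> 1"
  proof -
    have "tops t \<noteq> {#}" using "1.prems" size_edge_data[of t] by auto
    then have "tops ?v \<noteq> {#}" using coarsening_nonempty[OF h] coarsening_nonempty[OF v] by blast
    then show ?thesis using size_edge_data[of ?v] by (cases "n_edges ?v") auto
  qed
  show ?case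
  proof (cases "n_edges t > 1")
    case False
    then show ?thesis using "1.prems" by (simp add: greedy.simps[of t] del: of_nat_sum_mset)
  next
    case True
    have g: "greedy t = greedy ?v" using True by (simp add: greedy.simps[of t])
    note IH = "1.IH"[OF True ne, folded g, unfolded S L]
    have "real (card (large_subtrees K (tops (greedy t)))) \<le>
        card (large_subtrees K (tops t)) + 36 * sqrt (n_edges t) * sqrt (?S t / K)" if K: "K > 0"
    proof -
      let ?X = "sqrt (?S t / K)"
      \<comment> \<open>17/18 is a rational upper bound of sqrt (8/9), as 8/9 = 288/324 <
        289/324.\<close>
      have "real (n_edges ?v) \<le> (17 / 18)^2 * n_edges t"
        using n_edges_iteration[OF True] by (simp add: power2_eq_square)
      then have "sqrt (n_edges ?v) \<le> 17 / 18 * sqrt (n_edges t)"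
        by (intro real_le_lsqrt) (simp_all add: power_mult_distrib power_divide)
      moreover have X: "0 \<le> ?X" by (simp del: of_nat_sum_mset)
      ultimately have "sqrt (n_edges ?v) * ?X \<le> 17 / 18 * sqrt (n_edges t) * ?X"
        by (rule mult_right_mono)
      then have v': "36 * sqrt (n_edges ?v) * ?X \<le> 34 * sqrt (n_edges t) * ?X"
        by linarith
      have "n_edges ?h \<le> n_edges t" and "n_edges ?v \<le> n_edges t"
        using n_edges_horizontal_step[of t] n_edges_vertical_step_le[of ?h] by linarith+
      then have le: "sqrt (n_edges ?h) * ?X \<le> sqrt (n_edges t) * ?X"
          "sqrt (n_edges ?v) * ?X \<le> sqrt (n_edges t) * ?X"
        by (intro mult_right_mono[OF _ X]; simp)+
      have "real (card (large_subtrees K (flagged_tops ?h))) \<le>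
          card (large_subtrees K (tops t)) + sqrt (n_edges ?h) * ?X"
        using card_large_subtrees_coarsening[OF h K] by (simp add: size_edge_data)
      moreover have "real (card (large_subtrees K (tops ?v))) \<le>
          card (large_subtrees K (flagged_tops ?h)) + sqrt (n_edges ?v) * ?X"
        using card_large_subtrees_coarsening[OF v K] unfolding S by (simp add: size_edge_data)
      moreover have "real (card (large_subtrees K (tops (greedy t)))) \<le>
             card (large_subtrees K (tops ?v)) + 36 * sqrt (n_edges ?v) * ?X"
        using IH K by blast
      ultimately show ?thesis using v' le by linarith
    qed
    then show ?thesis using IH by blast
  qed
qed

section \<open>The initial clusters\<close>

lemma mem_sum_list_mset: "x \<in># (\<Sum>y\<leftarrow>ys. f y) \<longleftrightarrow> (\<exists>y \<in> set ys. x \<in># f y)"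
  by (induction ys) auto

lemma n_edges_initial_aux: "Suc (n_edges (initial_aux v T)) = n_nodes T"
proof (induction v T rule: initial_aux.induct)
  case (1 v a ts)
  have "edge_sum (map (\<lambda>i. ((Edge a (root_label (ts ! i)), edge_cluster v i (ts ! i)),
                    initial_aux (v @ [i]) (ts ! i))) [0..<length ts]) =
        sum_list (map (n_nodes \<circ> (!) ts) [0..<length ts])"
    unfolding edge_sum_def map_map comp_def snd_conv
    by (rule arg_cong[of _ _ sum_list], rule map_cong) (use 1 in auto)
  also have "\<dots> = sum_list (map n_nodes ts)"
    by (simp only: map_map[symmetric] map_nth)
  finally show ?case by simp
qed

lemma initial_aux_Edge:
  "s \<in># tops (initial_aux v T) \<Longrightarrow> \<exists>a \<in> set_tree T. \<exists>b \<in> set_tree T. s = Edge a b"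
proof (induction v T rule: initial_aux.induct)
  case (1 v a ts)
  have root: "root_label (ts ! i) \<in> set_tree (ts ! i)" for i by (cases "ts ! i") auto
  from 1(2) obtain i where i: "i < length ts" and
    s: "s = Edge a (root_label (ts ! i)) \<or> s \<in># tops (initial_aux (v @ [i]) (ts ! i))"
    by (force simp: mem_sum_list_mset image_mset_sum_list)
  have sub: "set_tree (ts ! i) \<subseteq> set_tree (Node a ts)" using i by auto
  from s show ?case
  proof
    assume "s \<in># tops (initial_aux (v @ [i]) (ts ! i))"
    from 1(1)[OF _ this] i sub show ?thesis by force
  qed (use root sub in force)
qed

section \<open>Small subtrees\<close>

text \<open>An injective code, which reduces counting small top trees to counting short
  words.\<close>

fun preorder :: "'a top_tree \<Rightarrow> ('a \<times> 'a + merge_type) list" where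
  "preorder (Edge a b) = [Inl (a, b)]"
| "preorder (Merge m s t) = Inr m # preorder s @ preorder t"

text \<open>The first letter tells a leaf from a merge, so the code is prefix-free. The suffixes are
  there because the code of a left child is followed by that of the right one.\<close>

lemma preorder_append_inj: "preorder s @ xs = preorder t @ ys \<Longrightarrow> s = t \<and> xs = ys"
proof (induction s arbitrary: t xs ys)
  case (Edge a b)
  then show ?case by (cases t) auto
next
  case (Merge m s1 s2)
  show ?case
  proof (cases t)
    case (Merge m' t1 t2)
    with Merge.prems have "m = m'"
      "preorder s1 @ (preorder s2 @ xs) = preorder t1 @ (preorder t2 @ ys)"
      by auto
    with Merge.IH Merge show ?thesis by metis
  qed (use Merge.prems in auto)
qed

lemma inj_preorder: "inj preorder"
  using preorder_append_inj[where xs = "[]" and ys = "[]"] by (auto intro: injI)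

lemma length_preorder: "Suc (length (preorder s)) = 2 * n_tree_edges s"
  by (induction s) auto

lemma set_preorder: "set (preorder s) \<subseteq> (set_top_tree s \<times> set_top_tree s) <+> UNIV"
  by (induction s) auto

lemma UNIV_merge_type: "UNIV = {Type_a, Type_b, Type_c, Type_d, Type_e}"
  using merge_type.exhaust by auto

text \<open>A top tree with k leaves is coded by 2 k - 1 letters, each a pair of labels or one of 5
  merge types.\<close>

lemma card_small_top_trees:
  assumes "finite A"
  shows "finite {s. set_top_tree s \<subseteq> A \<and> n_tree_edges s \<le> K}"
    and "card {s. set_top_tree s \<subseteq> A \<and> n_tree_edges s \<le> K} \<le> ((card A)\<^sup>2 + 6) ^ (2 * K)"
proof -
  let ?S = "{s. set_top_tree s \<subseteq> A \<and> n_tree_edges s \<le> K}"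
  let ?B = "(A \<times> A) <+> (UNIV :: merge_type set)"
  let ?L = "{xs. set xs \<subseteq> ?B \<and> length xs \<le> 2 * K}"
  have B: "finite ?B" "card ?B = (card A)\<^sup>2 + 5"
    using assms by (simp_all add: card_Plus UNIV_merge_type power2_eq_square)
  have sub: "preorder ` ?S \<subseteq> ?L"
  proof
    fix xs assume "xs \<in> preorder ` ?S"
    then obtain s where s: "xs = preorder s" "set_top_tree s \<subseteq> A" "n_tree_edges s \<le> K" by auto
    then show "xs \<in> ?L" using length_preorder[of s] set_preorder[of s] by auto
  qed
  have inj: "inj_on preorder ?S" using inj_preorder by (rule inj_on_subset) simp
  show "finite ?S"
    using finite_imageD[OF finite_subset[OF sub finite_lists_length_le[OF B(1)]] inj] .
  have "card ?S = card (preorder ` ?S)" using inj by (simp add: card_image)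
  also have "\<dots> \<le> card ?L" by (intro card_mono sub finite_lists_length_le B)
  also have "\<dots> = (\<Sum>i\<le>2 * K. card ?B ^ i)" by (rule card_lists_length_le[OF B(1)])
  \<comment> \<open>One extra letter absorbs the sum over the word lengths and turns 5 into
    6.\<close>
  also have "\<dots> \<le> (card ?B + 1) ^ (2 * K)"
  proof -
    have "(\<Sum>i\<le>n. q ^ i) \<le> (q + 1) ^ n" for q n :: nat
    proof (induction n)
      case (Suc n)
      have "q ^ Suc n \<le> q * (q + 1) ^ n" by (simp add: power_mono)
      from add_mono[OF Suc this] show ?case by (simp add: algebra_simps)
    qed simp
    then show ?thesis .
  qed
  finally show "card ?S \<le> ((card A)\<^sup>2 + 6) ^ (2 * K)" by (simp add: B(2) add.commute)
qed

section \<open>The size of the top DAG\<close>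

text \<open>A binary tree with k leaves has 2 k - 1 nodes. This ignores sharing and suffices when
  the logarithm in the theorem is below 16.\<close>

lemma card_subtrees_le: "card (subtrees s) < 2 * n_tree_edges s"
proof (induction s)
  case (Merge m s t)
  have "card (subtrees (Merge m s t)) \<le> Suc (card (subtrees s) + card (subtrees t))"
    using card_Un_le[of "subtrees s" "subtrees t"] card_insert_le_m1
    by (simp add: card_insert_if finite_subtrees)
  with Merge show ?case by simp
qed simp

text \<open>Every vertex has at most one left and one right edge, so two images of the vertex set
  cover the edges; \<open>undefined\<close> at an \<open>Edge\<close> only enlarges them.\<close>

lemma card_dag_edges_le: "card (dag_edges s) \<le> 2 * card (subtrees s)"
proof -
  let ?f = "\<lambda>u. case u of Merge m s t \<Rightarrow> (u, Left_child, s) | Edge a b \<Rightarrow> undefined"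
  let ?g = "\<lambda>u. case u of Merge m s t \<Rightarrow> (u, Right_child, t) | Edge a b \<Rightarrow> undefined"
  have "dag_edges s \<subseteq> ?f ` subtrees s \<union> ?g ` subtrees s"
    unfolding dag_edges_def dag_vertices_def by (intro Un_mono) (auto intro: rev_image_eqI)
  then have "card (dag_edges s) \<le> card (?f ` subtrees s \<union> ?g ` subtrees s)"
    by (intro card_mono) (auto simp: finite_subtrees)
  also have "\<dots> \<le> card (subtrees s) + card (subtrees s)"
    by (intro order_trans[OF card_Un_le] add_mono card_image_le finite_subtrees)
  finally show ?thesis by simp
qed

lemma subtrees_labels: "u \<in> subtrees s \<Longrightarrow> set_top_tree u \<subseteq> set_top_tree s"
  by (induction s) auto

text \<open>Initially every cluster is a single edge, so the total in \<open>greedy_result\<close>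
  is \<open>n_nodes T - 1\<close> and, for \<open>K > 0\<close>, no subtree is large yet.\<close>

lemma top_tree_of:
  assumes "n_nodes T \<ge> 2"
  shows "n_tree_edges (top_tree_of T) = n_nodes T - 1"
    and "set_top_tree (top_tree_of T) \<subseteq> set_tree T"
    and "K > 0 \<Longrightarrow> real (card {u \<in> subtrees (top_tree_of T). n_tree_edges u > K}) \<le> 36 * n_nodes T / sqrt K"
proof -
  let ?t = "initial_aux [] T"
  let ?S = "\<Sum>\<^sub># (image_mset n_tree_edges (tops ?t))"
  have n: "n_edges ?t = n_nodes T - 1" using n_edges_initial_aux[of "[]" T] by simp
  then have "n_edges ?t \<ge> 1" using assms by simp
  from greedy_result[OF this, of K] have
    g1: "n_edges (greedy ?t) = 1" and
    g2: "\<Sum>\<^sub># (image_mset n_tree_edges (tops (greedy ?t))) = ?S" and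
    g3: "(\<Union>s \<in> set_mset (tops (greedy ?t)). set_top_tree s) = (\<Union>s \<in> set_mset (tops ?t). set_top_tree s)" and
    g4: "K > 0 \<longrightarrow> real (card (large_subtrees K (tops (greedy ?t)))) \<le>
           card (large_subtrees K (tops ?t)) + 36 * sqrt (n_edges ?t) * sqrt (real ?S / K)"
    by blast+
  \<comment> \<open>One edge is left with nothing below it, and its data is the top tree.\<close>
  obtain e t where es: "greedy ?t = Aux [(e, t)]" "n_edges t = 0"
  proof (cases "greedy ?t")
    case (Aux es)
    with g1 that show ?thesis by (cases es; cases "tl es") auto
  qed
  then have "edge_data t = {#}" using size_edge_data[of t] by simp
  with es(1) have top: "tops (greedy ?t) = {#top_tree_of T#}" by (simp add: top_tree_of_def)
  have init: "\<exists>a \<in> set_tree T. \<exists>b \<in> set_tree T. s = Edge a b" if "s \<in># tops ?t" for s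
    using initial_aux_Edge that .
  have "image_mset n_tree_edges (tops ?t) = image_mset (\<lambda>_. 1) (tops ?t)"
    by (intro image_mset_cong) (use init in force)
  then have S: "?S = n_nodes T - 1" using n by (simp add: size_edge_data)
  show "n_tree_edges (top_tree_of T) = n_nodes T - 1" using g2 S by (simp add: top)
  show "set_top_tree (top_tree_of T) \<subseteq> set_tree T" using g3 init by (force simp: top)
  assume K: "K > 0"
  have "large_subtrees K (tops ?t) = {}"
    using init K by (force simp: large_subtrees_def all_subtrees_def)
  then have "real (card (large_subtrees K {#top_tree_of T#})) \<le> 36 * sqrt (n_nodes T - 1) * sqrt ((n_nodes T - 1) / K)"
    using g4 K by (simp add: n S top)
  also have "\<dots> = 36 * (n_nodes T - 1) / sqrt K"
    by (simp add: real_sqrt_divide)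
  also have "\<dots> \<le> 36 * n_nodes T / sqrt K"
    by (intro divide_right_mono) auto
  finally show "real (card {u \<in> subtrees (top_tree_of T). n_tree_edges u > K}) \<le> 36 * n_nodes T / sqrt K"
    by (simp add: large_subtrees_def all_subtrees_def)
qed

theorem theorem1:
  shows "\<exists>C > 0. \<forall>(\<Sigma> :: 'a set) (T :: 'a tree).
           finite \<Sigma> \<and> card \<Sigma> \<ge> 2 \<and> set_tree T \<subseteq> \<Sigma> \<and> n_nodes T \<ge> 2 \<longrightarrow>
           real (top_dag_size T) \<le>
             C * (real (n_nodes T) / log (real (card \<Sigma>)) (real (n_nodes T)) powr 0.19)"
proof (intro exI[of _ 700] conjI allI impI; (elim conjE)?)
  fix \<Sigma> :: "'a set" and T :: "'a tree"
  assume \<Sigma>: "finite \<Sigma>" "card \<Sigma> \<ge> 2" "set_tree T \<subseteq> \<Sigma>" and n2: "n_nodes T \<ge> 2"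
  define n where "n = n_nodes T"
  define \<sigma> where "\<sigma> = card \<Sigma>"
  define L where "L = log \<sigma> n"
  let ?V = "subtrees (top_tree_of T)"
  have n: "n \<ge> 2" and \<sigma>: "\<sigma> \<ge> 2" using n2 \<Sigma> by (simp_all add: n_def \<sigma>_def)
  have L: "L > 0" using n \<sigma> by (simp add: L_def)
  note top = top_tree_of[OF n2, folded n_def]
  have dag: "real (top_dag_size T) \<le> 3 * real (card ?V)"
    using card_dag_edges_le[of "top_tree_of T"] by (simp add: top_dag_size_def dag_vertices_def)
  \<comment> \<open>The first case needs 32 and the second 217; three times 230 is below
    700.\<close>
  have "real (card ?V) \<le> 230 * (n / L powr 0.19)"
  proof (cases "L < 16")
    case True
    have "L powr 0.19 \<le> 16 powr 0.19" using True L by (intro powr_mono2) auto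
    also have "\<dots> \<le> 16 powr 1" by (intro powr_mono) auto
    finally have "L powr 0.19 \<le> 16" by simp
    then have "2 * real n * L powr 0.19 \<le> 2 * real n * 16" by (intro mult_left_mono) auto
    also have "\<dots> \<le> 230 * n" by simp
    finally have "2 * real n \<le> 230 * (n / L powr 0.19)" using L by (simp add: field_simps)
    then show ?thesis using card_subtrees_le[of "top_tree_of T"] top(1) by simp
  next
    case False
    define K where "K = nat \<lfloor>L / 16\<rfloor>"
    have "1 \<le> \<lfloor>L / 16\<rfloor>" using False by simp
    \<comment> \<open>Rounding down a number that is at least 1 loses at most a factor 2.\<close>
    then have K: "K \<ge> 1" "real K \<le> L / 16" "L / 32 \<le> real K"
      unfolding K_def by linarith+
    \<comment> \<open>L \<le> n allows weakening sqrt n = n / sqrt n to n / sqrt L, the shape of the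
      bound for large subtrees.\<close>
    have "L \<le> log 2 n" unfolding L_def using n \<sigma>
      by (simp add: log_def frac_le)
    also have "\<dots> \<le> n"
      using n by (simp add: log_le_iff powr_realpow less_imp_le[OF of_nat_less_two_power])
    finally have Ln: "L \<le> n" .
    let ?small = "{u. set_top_tree u \<subseteq> \<Sigma> \<and> n_tree_edges u \<le> K}"
    let ?large = "{u \<in> ?V. n_tree_edges u > K}"
    have "?V \<subseteq> ?small \<union> ?large"
      using subtrees_labels top(2) \<Sigma>(3) by force
    then have "card ?V \<le> card ?small + card ?large"
      by (intro order_trans[OF card_mono card_Un_le])
         (auto simp: finite_subtrees card_small_top_trees[OF \<Sigma>(1)])
    moreover have "real (card ?small) \<le> n / sqrt L"
    proof -
      \<comment> \<open>For \<sigma> \<ge> 2 the 6 is at most 3 \<sigma>^2, and 4 \<sigma>^2 \<le>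
        \<sigma>^4. The total exponent becomes 8 K, at most L / 2.\<close>
      have "\<sigma>\<^sup>2 + 6 \<le> \<sigma> ^ 4"
      proof -
        have "2\<^sup>2 \<le> \<sigma>\<^sup>2" using \<sigma> by (intro power_mono) auto
        then have "4 \<le> \<sigma>\<^sup>2" "4 * \<sigma>\<^sup>2 \<le> \<sigma>\<^sup>2 * \<sigma>\<^sup>2"
          by (simp, intro mult_right_mono) auto
        moreover have "\<sigma> ^ 4 = \<sigma>\<^sup>2 * \<sigma>\<^sup>2" by (simp flip: power_add)
        ultimately show ?thesis by linarith
      qed
      then have "(\<sigma>\<^sup>2 + 6) ^ (2 * K) \<le> (\<sigma> ^ 4) ^ (2 * K)" by (intro power_mono) auto
      then have "card ?small \<le> \<sigma> ^ (8 * K)"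
        using card_small_top_trees(2)[OF \<Sigma>(1), of K] by (simp add: \<sigma>_def flip: power_mult)
      then have "real (card ?small) \<le> real \<sigma> ^ (8 * K)" by (simp flip: of_nat_power)
      also have "\<dots> = real \<sigma> powr (8 * K)" using \<sigma> by (simp flip: powr_realpow)
      also have "\<dots> \<le> real \<sigma> powr (L / 2)" using \<sigma> K(2) by (intro powr_mono) auto
      also have "\<dots> = (real \<sigma> powr L) powr (1 / 2)" by (simp add: powr_powr)
      also have "\<dots> = sqrt n" using n \<sigma> by (simp add: L_def powr_half_sqrt)
      also have "\<dots> = n / sqrt n" by (simp add: real_div_sqrt)
      also have "\<dots> \<le> n / sqrt L" using L Ln by (intro divide_left_mono) auto
      finally show ?thesis .
    qed
    moreover have "real (card ?large) \<le> 216 * (n / sqrt L)"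
    proof -
      \<comment> \<open>L \<le> 32 K is relaxed to the square 36, whose root gives 216 = 6 *
        36.\<close>
      have "sqrt L \<le> sqrt (36 * K)" using K(3) by (intro real_sqrt_le_mono) simp
      then have "sqrt L \<le> 6 * sqrt K" by (simp add: real_sqrt_mult)
      then have "36 * n / sqrt K \<le> 36 * n * 6 / sqrt L"
        using L K(1) mult_left_mono[of "sqrt L" "6 * sqrt K" n] by (simp add: divide_simps)
      then show ?thesis using top(3)[of K] K(1) by simp
    qed
    ultimately have "real (card ?V) \<le> 217 * (n / sqrt L)" by linarith
    also have "\<dots> \<le> 217 * (n / L powr 0.19)"
    proof -
      \<comment> \<open>As L is at least 1 here, the exponent 1/2 may be lowered to 0.19.\<close>
      have "L powr 0.19 \<le> L powr (1 / 2)" using False by (intro powr_mono) auto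
      then have "L powr 0.19 \<le> sqrt L" using L by (simp add: powr_half_sqrt)
      then show ?thesis using L by (intro mult_left_mono divide_left_mono) auto
    qed
    also have "\<dots> \<le> 230 * (n / L powr 0.19)" by (intro mult_right_mono) auto
    finally show ?thesis .
  qed
  moreover have "0 \<le> n / L powr 0.19" by simp
  ultimately have "real (top_dag_size T) \<le> 700 * (n / L powr 0.19)" using dag by linarith
  then show "real (top_dag_size T) \<le> 700 * (n_nodes T / log (card \<Sigma>) (n_nodes T) powr 0.19)"
    by (simp only: L_def n_def \<sigma>_def)
qed simp

end
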